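(* Let $0<q<1$, let $m$ be a nonnegative integer and let $\{A_n\}$ be an arbitrary sequence of complex numbers. Let $\alpha,a,b$ be complex numbers such that no zero factors occur in the denominators below. Then $$\frac{(\alpha q,\alpha ab/q;q)_m}{(\alpha a,\alpha b;q)_m}\sum_{n=0}^m\frac{(q^{-m},q/a,q/b;q)_n\,q^n}{(q^2/(\alpha ab q^m);q)_n}A_n$$ $$=\sum_{n=0}^m\frac{(1-\alpha q^{2n})(q^{-m},\alpha,q/a,q/b;q)_n(\alpha ab q^{m-1})^n}{(1-\alpha)(q,\alpha q^{m+1},\alpha a,\alpha b;q)_n}\sum_{k=0}^n(q^{-n},\alpha q^n;q)_k\,q^kA_k.$$
   Context: $(a;q)_0=1$, $(a;q)_n=\prod_{k=0}^{n-1}(1-aq^k)$, and $(a_1,a_2,\ldots,a_r;q)_n=(a_1;q)_n(a_2;q)_n\cdots(a_r;q)_n$. *)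

theory Defs
  imports Complex_Main
begin

definition qpoch :: "'a::comm_ring_1 \<Rightarrow> 'a \<Rightarrow> nat \<Rightarrow> 'a" where
  "qpoch a q n = (\<Prod>k<n. 1 - a * q ^ k)"

definition qpochs :: "'a::comm_ring_1 list \<Rightarrow> 'a \<Rightarrow> nat \<Rightarrow> 'a" where
  "qpochs as q n = (\<Prod>a\<leftarrow>as. qpoch a q n)"

end

theory Submission
  imports Defs
begin

text \<open>
  Both sides are linear in the sequence \<open>A\<close>, so it suffices to compare the coefficients of each
  \<open>A k\<close>. On the left this coefficient is a single product. On the right it is a sum over
  \<open>n = k, ..., m\<close>; with \<open>n = k + j\<close> it becomes a constant (\<open>shift_factor\<close>) times the terminating
  very-well-poised series \<open>\<^sub>6\<phi>\<^sub>5\<close> in which \<open>\<alpha>, a, b, m\<close> are replaced by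
  \<open>\<alpha> q\<^sup>2\<^sup>k, a / q\<^sup>k, b / q\<^sup>k, m - k\<close> (lemma \<open>expansion_coeff_shift\<close>). These substitutions keep
  \<open>\<alpha> a b q\<^sup>m\<^sup>-\<^sup>1\<close> fixed up to a factor \<open>q\<^sup>k\<close>, whose \<open>j\<close>-th power is what appears when
  \<open>(q\<^sup>-\<^sup>n; q)\<^sub>k\<close> is divided by \<open>(q; q)\<^sub>n\<close>. Rogers' closed form of the \<open>\<^sub>6\<phi>\<^sub>5\<close> sum
  (lemma \<open>vwp_sum\<close>) then gives the coefficient on the left, after one reversal of a
  \<open>q\<close>-shifted factorial (lemma \<open>shift_factor_vwp_sum\<close>).

  The delicate point is degeneracy: \<open>\<alpha> q\<^sup>i = 1\<close> is possible for \<open>1 \<le> i \<le> m\<close>. The shifted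
  parameter \<open>\<alpha> q\<^sup>2\<^sup>k\<close> may then equal \<open>1\<close>, where the usual normalisation of the \<open>\<^sub>6\<phi>\<^sub>5\<close> series by
  \<open>1 - \<alpha> q\<^sup>2\<^sup>k\<close> breaks down, and an induction on \<open>M\<close> would meet vanishing denominators
  \<open>(\<alpha> q\<^sup>M\<^sup>+\<^sup>1; q)\<^sub>j\<close>. The sum is therefore evaluated after multiplication by
  \<open>(1 - \<alpha>) (\<alpha> q\<^sup>M\<^sup>+\<^sup>1; q)\<^sub>M\<close>. In this form the shifted factorials in its denominators are only \<open>(q; q)\<^sub>j\<close>, \<open>(\<alpha> a; q)\<^sub>j\<close>
  and \<open>(\<alpha> b; q)\<^sub>j\<close>. It obeys a first-order recurrence in \<open>M\<close>, proved by the
  Wilf--Zeilberger method: the difference of the summands telescopes in \<open>j\<close>, by the rational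
  identity \<open>vwp_certificate\<close>.

  The argument is purely algebraic: under the same conditions on \<open>\<alpha>, a, b\<close> it works over every
  field, for every nonzero \<open>q\<close> that is not a root of unity (theorem \<open>q_expansion\<close>).
\<close>

section \<open>Shifted factorials\<close>

lemma qpoch_0 [simp]: "qpoch a q 0 = 1"
  by (simp add: qpoch_def)

lemma qpoch_Suc: "qpoch a q (Suc n) = qpoch a q n * (1 - a * q ^ n)"
  by (simp add: qpoch_def)

lemma qpoch_add: "qpoch a q (m + n) = qpoch a q m * qpoch (a * q ^ m) q n"
  by (induction n) (simp_all add: qpoch_Suc power_add algebra_simps)

lemma qpoch_Suc_left: "qpoch a q (Suc n) = (1 - a) * qpoch (a * q) q n"
  using qpoch_add[of a q 1 n] by (simp add: qpoch_Suc)

lemma qpoch_nonzero_mono: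
  fixes a q :: "'a::field"
  assumes "qpoch a q n \<noteq> 0" "k \<le> n"
  shows "qpoch a q k \<noteq> 0"
  using assms qpoch_add[of a q k "n - k"] by auto

text \<open>
  Taking the factors in the opposite order and pulling \<open>- c q\<^sup>k\<^sup>-\<^sup>1\<^sup>-\<^sup>i\<close> out of each of them turns the
  base \<open>c\<close> into its reflection \<open>1 / (c q\<^sup>k\<^sup>-\<^sup>1)\<close>.
\<close>
lemma qpoch_reverse:
  fixes c q :: "'a::field"
  assumes "c \<noteq> 0" "q \<noteq> 0"
  shows "qpoch c q k = qpoch (q / (c * q ^ k)) q k * (\<Prod>i<k. - (c * q ^ (k - Suc i)))"
proof -
  have "qpoch c q k = (\<Prod>i<k. 1 - c * q ^ (k - Suc i))"
    unfolding qpoch_def by (rule prod.nat_diff_reindex[symmetric])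
  also have "\<dots> = (\<Prod>i<k. (1 - q / (c * q ^ k) * q ^ i) * - (c * q ^ (k - Suc i)))"
  proof (rule prod.cong[OF refl])
    fix i assume "i \<in> {..<k}"
    then have "q ^ k = q * q ^ i * q ^ (k - Suc i)"
      by (simp flip: power_add power_Suc)
    then show "1 - c * q ^ (k - Suc i) =
        (1 - q / (c * q ^ k) * q ^ i) * - (c * q ^ (k - Suc i))"
      using assms by (simp add: field_simps)
  qed
  also have "\<dots> = qpoch (q / (c * q ^ k)) q k * (\<Prod>i<k. - (c * q ^ (k - Suc i)))"
    unfolding qpoch_def by (rule prod.distrib)
  finally show ?thesis .
qed

lemma qpoch_self_nonzero:
  fixes q :: "'a::field"
  assumes "\<And>k. 0 < k \<Longrightarrow> q ^ k \<noteq> 1"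
  shows "qpoch q q n \<noteq> 0"
  using assms[of "Suc _"] by (auto simp: qpoch_def)

text \<open>
  The quotient \<open>(q\<^sup>-\<^sup>n; q)\<^sub>k / (q; q)\<^sub>n\<close> for \<open>n = k + j\<close>, which equals \<open>1 / (q; q)\<^sub>j\<close> up to a
  signed power of \<open>q\<close>. The dependence of that power on \<open>j\<close> is the pure exponential \<open>q\<^sup>j\<^sup>k\<close>, so it
  can be absorbed into the argument of a series over \<open>j\<close>.
\<close>
lemma qpoch_inverse_power:
  fixes q :: "'a::field"
  assumes "q \<noteq> 0"
  shows "qpoch q q (k + j) = qpoch q q j * qpoch (1 / q ^ (k + j)) q k *
     (q ^ (j * k) * (\<Prod>i<k. - (q * q ^ (k - Suc i))))"
proof -
  have "qpoch q q (k + j) = qpoch q q j * qpoch (q * q ^ j) q k"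
    using qpoch_add[of q q j k] by (simp add: add.commute)
  also have "qpoch (q * q ^ j) q k = qpoch (1 / q ^ (k + j)) q k *
      (\<Prod>i<k. q ^ j * - (q * q ^ (k - Suc i)))"
    using qpoch_reverse[of "q * q ^ j" q k] assms by (simp add: power_add ac_simps)
  also have "(\<Prod>i<k. q ^ j * - (q * q ^ (k - Suc i))) =
      q ^ (j * k) * (\<Prod>i<k. - (q * q ^ (k - Suc i)))"
    unfolding prod.distrib by (simp add: power_mult)
  finally show ?thesis by simp
qed

text \<open>
  Pairing the factor \<open>i\<close> of one product with the factor \<open>k - 1 - i\<close> of the other makes
  all \<open>k\<close> pairs equal. The two products are the ones that arise from reversing \<open>(q; q)\<^sub>k\<close>
  and \<open>(c; q)\<^sub>k\<close>.
\<close>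
lemma prod_power_pair:
  fixes q :: "'a::field"
  shows "(\<Prod>i<k. - (q * q ^ (k - Suc i))) * (\<Prod>i<k. - (c * q ^ (k - Suc i))) = (c * q ^ k) ^ k"
proof -
  have "(\<Prod>i<k. - (q * q ^ (k - Suc i))) = (\<Prod>i<k. - (q * q ^ i))"
    by (rule prod.nat_diff_reindex)
  then have "(\<Prod>i<k. - (q * q ^ (k - Suc i))) * (\<Prod>i<k. - (c * q ^ (k - Suc i))) =
      (\<Prod>i<k. (- (q * q ^ i)) * - (c * q ^ (k - Suc i)))"
    by (simp only: prod.distrib)
  also have "\<dots> = (\<Prod>i<k. c * q ^ k)"
  proof (rule prod.cong[OF refl])
    fix i assume "i \<in> {..<k}"
    then have "q ^ k = q * q ^ i * q ^ (k - Suc i)"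
      by (simp flip: power_add power_Suc)
    then show "(- (q * q ^ i)) * - (c * q ^ (k - Suc i)) = c * q ^ k"
      by simp
  qed
  finally show ?thesis by simp
qed

section \<open>The terminating very-well-poised sum\<close>

text \<open>
  The summand of the terminating \<open>\<^sub>6\<phi>\<^sub>5\<close> series without its very-well-poised part
  \<open>(1 - \<alpha> q\<^sup>2\<^sup>j) / (1 - \<alpha>)\<close> and without the denominator \<open>(\<alpha> q\<^sup>M\<^sup>+\<^sup>1; q)\<^sub>j\<close>. These two parts
  are cleared of denominators separately, in \<open>vwp_summand\<close>.
\<close>
definition wp_term :: "'a::field \<Rightarrow> 'a \<Rightarrow> 'a \<Rightarrow> 'a \<Rightarrow> nat \<Rightarrow> nat \<Rightarrow> 'a" where
  "wp_term \<alpha> a b q M j =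
     qpoch (1 / q ^ M) q j * qpoch \<alpha> q j * qpoch (q / a) q j * qpoch (q / b) q j *
     (\<alpha> * a * b * q ^ M / q) ^ j /
     (qpoch q q j * qpoch (\<alpha> * a) q j * qpoch (\<alpha> * b) q j)"

lemma wp_term_0 [simp]: "wp_term \<alpha> a b q M 0 = 1"
  by (simp add: wp_term_def)

lemma wp_term_Suc:
  fixes q :: "'a::field"
  assumes "q \<noteq> 0" "a \<noteq> 0" "b \<noteq> 0"
  shows "wp_term \<alpha> a b q M (Suc j) = wp_term \<alpha> a b q M j *
     ((1 - \<alpha> * q ^ j) * (q ^ M - q ^ j) * (a - q * q ^ j) * (b - q * q ^ j) * \<alpha> /
      (q * (1 - q * q ^ j) * (1 - \<alpha> * a * q ^ j) * (1 - \<alpha> * b * q ^ j)))"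
proof -
  have eq: "(1 - 1 / q ^ M * q ^ j) * (1 - \<alpha> * q ^ j) * (1 - q / a * q ^ j) * (1 - q / b * q ^ j) *
      (\<alpha> * a * b * q ^ M / q) =
      (1 - \<alpha> * q ^ j) * (q ^ M - q ^ j) * (a - q * q ^ j) * (b - q * q ^ j) * \<alpha> / q"
    using assms by (simp add: divide_simps)
  have N: "(1 - 1 / q ^ M * q ^ j) * (1 - \<alpha> * q ^ j) * (1 - q / a * q ^ j) * (1 - q / b * q ^ j) *
      (\<alpha> * a * b * q ^ M / q) / D =
      (1 - \<alpha> * q ^ j) * (q ^ M - q ^ j) * (a - q * q ^ j) * (b - q * q ^ j) * \<alpha> / (q * D)" for D
    by (simp only: eq divide_divide_eq_left)
  have "wp_term \<alpha> a b q M (Suc j) = wp_term \<alpha> a b q M j *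
      ((1 - 1 / q ^ M * q ^ j) * (1 - \<alpha> * q ^ j) * (1 - q / a * q ^ j) * (1 - q / b * q ^ j) *
      (\<alpha> * a * b * q ^ M / q) /
      ((1 - q * q ^ j) * (1 - \<alpha> * a * q ^ j) * (1 - \<alpha> * b * q ^ j)))"
    unfolding wp_term_def qpoch_Suc power_Suc2 times_divide_times_eq by (simp only: ac_simps)
  then show ?thesis
    unfolding N by (simp only: ac_simps)
qed

text \<open>
  Only \<open>(q\<^sup>-\<^sup>M; q)\<^sub>j\<close> and the argument of the series depend on \<open>M\<close>, so the quotient of neighbouring
  terms is elementary. The quotient has a pole at \<open>j = M + 1\<close>; in the cleared form the
  induction on \<open>j\<close> passes it without a case distinction.
\<close>
lemma wp_term_raise_M:
  fixes q :: "'a::field"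
  assumes "q \<noteq> 0" "a \<noteq> 0" "b \<noteq> 0"
  shows "(q ^ j - q * q ^ M) * wp_term \<alpha> a b q (Suc M) j =
     q ^ j * (1 - q * q ^ M) * wp_term \<alpha> a b q M j"
proof (induction j)
  case (Suc j)
  define c where "c = (1 - \<alpha> * q ^ j) * (a - q * q ^ j) * (b - q * q ^ j) * \<alpha> /
      (q * (1 - q * q ^ j) * (1 - \<alpha> * a * q ^ j) * (1 - \<alpha> * b * q ^ j))"
  have s: "wp_term \<alpha> a b q N (Suc j) = wp_term \<alpha> a b q N j * (q ^ N - q ^ j) * c" for N
    unfolding wp_term_Suc[OF assms] c_def by (simp add: ac_simps)
  have "(q ^ Suc j - q * q ^ M) * wp_term \<alpha> a b q (Suc M) (Suc j) =
      - q * (q ^ j - q ^ M) * c * ((q ^ j - q * q ^ M) * wp_term \<alpha> a b q (Suc M) j)"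
    unfolding s by (simp add: algebra_simps)
  also have "\<dots> = q ^ Suc j * (1 - q * q ^ M) * wp_term \<alpha> a b q M (Suc j)"
    unfolding Suc.IH s by (simp add: algebra_simps)
  finally show ?case .
qed simp

text \<open>
  The rational identity behind the telescoping, with \<open>x = q\<^sup>j\<close> and \<open>Q = q\<^sup>M\<close>. Up to a common
  factor, the left side is the summand for \<open>M + 1\<close> minus a multiple of the summand for \<open>M\<close>, and the
  two terms on the right are the antidifference at \<open>j + 1\<close> and minus the antidifference at \<open>j\<close>.
  The antidifference has to vanish at \<open>x = 1\<close>, where the summation starts, and to reproduce the pole
  of the left side at \<open>x = q Q\<close>; the residue there determines its constant factor.
\<close>
lemma vwp_certificate:
  fixes q :: "'a::field"
  assumes "q \<noteq> 0" "1 - \<alpha> * a * Q \<noteq> 0" "1 - \<alpha> * b * Q \<noteq> 0" "x - q * Q \<noteq> 0"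
  shows "(1 - \<alpha> * x\<^sup>2) * (x * (1 - q * Q) / (x - q * Q) -
      (1 - \<alpha> * a * b * Q / q) * (1 - \<alpha> * q * Q * x) / ((1 - \<alpha> * a * Q) * (1 - \<alpha> * b * Q))) =
    \<alpha> * Q * (1 - \<alpha> * x) * (a - q * x) * (b - q * x) / (q * ((1 - \<alpha> * a * Q) * (1 - \<alpha> * b * Q))) +
    q * Q * (1 - x) * (1 - \<alpha> * a * x / q) * (1 - \<alpha> * b * x / q) * (1 - \<alpha> * q * Q * x) /
      ((1 - \<alpha> * a * Q) * (1 - \<alpha> * b * Q) * (x - q * Q))"
proof -
  define A B X where "A = 1 - \<alpha> * a * Q" and "B = 1 - \<alpha> * b * Q" and "X = x - q * Q"
  have nz: "A \<noteq> 0" "B \<noteq> 0" "X \<noteq> 0" using assms by (simp_all add: A_def B_def X_def)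
  have poly: "q * (1 - \<alpha> * x\<^sup>2) * (q * x * (1 - q * Q) * A * B - (q - \<alpha> * a * b * Q) * (1 - \<alpha> * q * Q * x) * X) =
    q * \<alpha> * Q * (1 - \<alpha> * x) * (a - q * x) * (b - q * x) * X +
    q * Q * (1 - x) * (q - \<alpha> * a * x) * (q - \<alpha> * b * x) * (1 - \<alpha> * q * Q * x)"
    unfolding A_def B_def X_def by algebra
  have "(1 - \<alpha> * x\<^sup>2) * (x * (1 - q * Q) / X - (1 - \<alpha> * a * b * Q / q) * (1 - \<alpha> * q * Q * x) / (A * B)) =
    q * (1 - \<alpha> * x\<^sup>2) * (q * x * (1 - q * Q) * A * B - (q - \<alpha> * a * b * Q) * (1 - \<alpha> * q * Q * x) * X) /
      (q\<^sup>2 * A * B * X)"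
  proof -
    have "u * (x * v / X - (1 - w / q) * y / (A * B)) =
        q * u * (q * x * v * A * B - (q - w) * y * X) / (q\<^sup>2 * A * B * X)" for u v w y
      using nz assms(1) by (simp add: field_simps power2_eq_square)
    then show ?thesis .
  qed
  also have "\<dots> =
      (q * \<alpha> * Q * (1 - \<alpha> * x) * (a - q * x) * (b - q * x) * X +
       q * Q * (1 - x) * (q - \<alpha> * a * x) * (q - \<alpha> * b * x) * (1 - \<alpha> * q * Q * x)) /
      (q\<^sup>2 * A * B * X)"
    by (simp only: poly)
  also have "\<dots> =
      \<alpha> * Q * (1 - \<alpha> * x) * (a - q * x) * (b - q * x) / (q * (A * B)) +
      q * Q * (1 - x) * (1 - \<alpha> * a * x / q) * (1 - \<alpha> * b * x / q) * (1 - \<alpha> * q * Q * x) / (A * B * X)"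
  proof -
    have "(q * \<alpha> * Q * r * s * t * X + q * Q * u * (q - v) * (q - w) * y) / (q\<^sup>2 * A * B * X) =
        \<alpha> * Q * r * s * t / (q * (A * B)) + q * Q * u * (1 - v / q) * (1 - w / q) * y / (A * B * X)"
      for r s t u v w y
      using nz assms(1) by (simp add: field_simps power2_eq_square)
    then show ?thesis .
  qed
  finally show ?thesis
    unfolding A_def B_def X_def .
qed

text \<open>
  The summand of the \<open>\<^sub>6\<phi>\<^sub>5\<close> series times \<open>(1 - \<alpha>) (\<alpha> q\<^sup>M\<^sup>+\<^sup>1; q)\<^sub>M\<close>: since
  \<open>(\<alpha> q\<^sup>M\<^sup>+\<^sup>1; q)\<^sub>M = (\<alpha> q\<^sup>M\<^sup>+\<^sup>1; q)\<^sub>j (\<alpha> q\<^sup>M\<^sup>+\<^sup>1\<^sup>+\<^sup>j; q)\<^sub>M\<^sub>-\<^sub>j\<close>, the denominators that involve only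
  \<open>\<alpha>\<close> disappear.
\<close>
definition vwp_summand :: "'a::field \<Rightarrow> 'a \<Rightarrow> 'a \<Rightarrow> 'a \<Rightarrow> nat \<Rightarrow> nat \<Rightarrow> 'a" where
  "vwp_summand \<alpha> a b q M j =
     (1 - \<alpha> * q ^ (2 * j)) * wp_term \<alpha> a b q M j * qpoch (\<alpha> * q ^ (M + 1 + j)) q (M - j)"

text \<open>
  The quotient of the closed forms of the sum for \<open>M + 1\<close> and for \<open>M\<close>.
\<close>
definition vwp_step :: "'a::field \<Rightarrow> 'a \<Rightarrow> 'a \<Rightarrow> 'a \<Rightarrow> nat \<Rightarrow> 'a" where
  "vwp_step \<alpha> a b q M = (1 - \<alpha> * q ^ (2 * M + 1)) * (1 - \<alpha> * q ^ (2 * M + 2)) *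
     (1 - \<alpha> * a * b * q ^ M / q) / ((1 - \<alpha> * a * q ^ M) * (1 - \<alpha> * b * q ^ M))"

text \<open>
  The antidifference in \<open>j\<close> of the summand for \<open>M + 1\<close> minus \<open>vwp_step\<close> times the summand for \<open>M\<close>.
  The factor \<open>1 - q\<^sup>j\<close> makes it vanish at \<open>j = 0\<close>; together with the factors in \<open>\<alpha> a q\<^sup>j\<^sup>-\<^sup>1\<close> and
  \<open>\<alpha> b q\<^sup>j\<^sup>-\<^sup>1\<close> it cancels the last factor of each denominator of \<open>wp_term\<close>.
\<close>
definition vwp_antidiff :: "'a::field \<Rightarrow> 'a \<Rightarrow> 'a \<Rightarrow> 'a \<Rightarrow> nat \<Rightarrow> nat \<Rightarrow> 'a" where
  "vwp_antidiff \<alpha> a b q M j = - ((1 - \<alpha> * q ^ (2 * M + 1)) * (1 - \<alpha> * q ^ (2 * M + 2)) *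
     wp_term \<alpha> a b q M j * qpoch (\<alpha> * q ^ (M + 1 + j)) q (M - j) *
     (q * q ^ M * (1 - q ^ j) * (1 - \<alpha> * a * q ^ j / q) * (1 - \<alpha> * b * q ^ j / q) /
      ((1 - \<alpha> * a * q ^ M) * (1 - \<alpha> * b * q ^ M) * (q ^ j - q * q ^ M))))"

lemma power_eq_imp_eq_index:
  fixes q :: "'a::field"
  assumes "q \<noteq> 0" "\<And>k. 0 < k \<Longrightarrow> q ^ k \<noteq> 1" "q ^ i = q ^ j"
  shows "i = j"
proof (rule ccontr)
  assume "i \<noteq> j"
  then have "q ^ (max i j - min i j) = 1"
    using assms(1,3) by (cases i j rule: linorder_cases) (simp_all add: power_diff)
  with assms(2)[of "max i j - min i j"] \<open>i \<noteq> j\<close> show False by linarith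
qed

lemma wp_term_raise_M_divide:
  fixes q :: "'a::field"
  assumes "q \<noteq> 0" "a \<noteq> 0" "b \<noteq> 0" "q ^ j \<noteq> q * q ^ M"
  shows "wp_term \<alpha> a b q (Suc M) j =
     q ^ j * (1 - q * q ^ M) / (q ^ j - q * q ^ M) * wp_term \<alpha> a b q M j"
  using wp_term_raise_M[OF assms(1-3), of j M \<alpha>] assms(4) by (simp add: field_simps)

text \<open>
  For \<open>j < M\<close>, but not for \<open>j = M\<close>, the two shifted factorials
  \<open>(\<alpha> q\<^sup>M\<^sup>+\<^sup>1\<^sup>+\<^sup>j; q)\<^sub>M\<^sub>-\<^sub>j\<close> and \<open>(\<alpha> q\<^sup>M\<^sup>+\<^sup>2\<^sup>+\<^sup>j; q)\<^sub>M\<^sub>+\<^sub>1\<^sub>-\<^sub>j\<close> share the common part \<open>C\<close> below, and everything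
  else is a rational function of \<open>x = q\<^sup>j\<close> and \<open>Q = q\<^sup>M\<close>.
\<close>
lemma vwp_antidiff_Suc:
  fixes q :: "'a::field"
  assumes "q \<noteq> 0" "a \<noteq> 0" "b \<noteq> 0" "j < M"
    and root: "\<And>k. 0 < k \<Longrightarrow> q ^ k \<noteq> 1"
    and nz: "1 - \<alpha> * a * q ^ j \<noteq> 0" "1 - \<alpha> * b * q ^ j \<noteq> 0"
      "1 - \<alpha> * a * q ^ M \<noteq> 0" "1 - \<alpha> * b * q ^ M \<noteq> 0"
  shows "vwp_summand \<alpha> a b q (Suc M) j - vwp_step \<alpha> a b q M * vwp_summand \<alpha> a b q M j =
     vwp_antidiff \<alpha> a b q M (Suc j) - vwp_antidiff \<alpha> a b q M j"
proof -
  define x Q D C W P where "x = q ^ j" and "Q = q ^ M"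
    and "D = (1 - \<alpha> * a * Q) * (1 - \<alpha> * b * Q)"
    and "C = qpoch (\<alpha> * q ^ (M + 2 + j)) q (M - j - 1)"
    and "W = wp_term \<alpha> a b q M j"
    and "P = (1 - \<alpha> * q ^ (2 * M + 1)) * (1 - \<alpha> * q ^ (2 * M + 2))"
  have xQ: "x - q * Q \<noteq> 0" "Q - x \<noteq> 0" "1 - q * x \<noteq> 0"
    using power_eq_imp_eq_index[OF assms(1) root, of j "Suc M"]
      power_eq_imp_eq_index[OF assms(1) root, of j M] root[of "Suc j"] assms(4)
    by (auto simp: x_def Q_def)
  have nz': "1 - \<alpha> * a * x \<noteq> 0" "1 - \<alpha> * b * x \<noteq> 0" "D \<noteq> 0"
    using nz by (auto simp: x_def Q_def D_def)
  have x2: "q ^ (2 * j) = x\<^sup>2"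
    by (simp add: x_def power_mult[symmetric] mult.commute)
  have split: "M - j = Suc (M - j - 1)" "Suc M - j = (M - j - 1) + 2"
    using assms(4) by simp_all
  have E: "qpoch (\<alpha> * q ^ (M + 1 + j)) q (M - j) = (1 - \<alpha> * q * Q * x) * C"
    by (subst split(1)) (simp add: qpoch_Suc_left C_def Q_def x_def power_add ac_simps)
  have E': "qpoch (\<alpha> * q ^ (Suc M + 1 + j)) q (Suc M - j) = C * P"
  proof -
    have "M + 2 + j + (M - j - 1) = 2 * M + 1" using assms(4) by simp
    then have "q ^ (M + 2 + j) * q ^ (M - j - 1) = q ^ (2 * M + 1)"
      by (simp only: power_add[symmetric])
    then have eq: "\<alpha> * q ^ (M + 2 + j) * q ^ (M - j - 1) = \<alpha> * q ^ (2 * M + 1)"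
      by (simp only: mult.assoc)
    have "qpoch (\<alpha> * q ^ (M + 2 + j) * q ^ (M - j - 1)) q 2 = P"
      unfolding eq by (simp add: numeral_2_eq_2 qpoch_Suc P_def ac_simps)
    then show ?thesis
      unfolding split(2) qpoch_add C_def by simp
  qed
  have S: "vwp_summand \<alpha> a b q M j = (1 - \<alpha> * x\<^sup>2) * W * ((1 - \<alpha> * q * Q * x) * C)"
    unfolding vwp_summand_def E x2 W_def ..
  have S': "vwp_summand \<alpha> a b q (Suc M) j =
      (1 - \<alpha> * x\<^sup>2) * (x * (1 - q * Q) / (x - q * Q) * W) * (C * P)"
    unfolding vwp_summand_def E' x2
    using wp_term_raise_M_divide[OF assms(1-3), of j M \<alpha>] xQ(1) by (simp add: x_def Q_def W_def)
  have R: "vwp_step \<alpha> a b q M = P * (1 - \<alpha> * a * b * Q / q) / D"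
    by (simp add: vwp_step_def P_def Q_def D_def)
  have G: "vwp_antidiff \<alpha> a b q M j = - (P * W * C * (q * Q * (1 - x) * (1 - \<alpha> * a * x / q) *
      (1 - \<alpha> * b * x / q) * (1 - \<alpha> * q * Q * x) / (D * (x - q * Q))))"
    unfolding vwp_antidiff_def E W_def x_def Q_def P_def D_def by simp
  have "M + 1 + Suc j = M + 2 + j" "M - Suc j = M - j - 1" by simp_all
  then have G': "vwp_antidiff \<alpha> a b q M (Suc j) = - (P *
      (W * ((1 - \<alpha> * x) * (Q - x) * (a - q * x) * (b - q * x) * \<alpha> /
      (q * (1 - q * x) * (1 - \<alpha> * a * x) * (1 - \<alpha> * b * x)))) * C *
      (q * Q * (1 - q * x) * (1 - \<alpha> * a * x) * (1 - \<alpha> * b * x) / (D * (q * x - q * Q))))"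
    unfolding vwp_antidiff_def wp_term_Suc[OF assms(1-3)] W_def x_def Q_def P_def D_def C_def
    by (simp add: ac_simps)
  have "- (P * (W * (r * (Q - x) * s * t * \<alpha> / (q * u * v * w))) * C *
      (q * Q * u * v * w / (D * (q * x - q * Q)))) =
      P * W * C * (\<alpha> * Q * r * s * t / (q * D))"
    if "u \<noteq> 0" "v \<noteq> 0" "w \<noteq> 0" for r s t u v w
  proof -
    define y where "y = Q - x"
    have y: "q * x - q * Q = - (q * y)" "y \<noteq> 0" using xQ by (simp_all add: y_def algebra_simps)
    show ?thesis
      unfolding y y_def[symmetric] using that assms(1) y(2) nz'(3) by (simp add: field_simps)
  qed
  from this[OF xQ(3) nz'(1,2)] have G'': "vwp_antidiff \<alpha> a b q M (Suc j) =
      P * W * C * (\<alpha> * Q * (1 - \<alpha> * x) * (a - q * x) * (b - q * x) / (q * D))"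
    unfolding G' .
  have "vwp_summand \<alpha> a b q (Suc M) j - vwp_step \<alpha> a b q M * vwp_summand \<alpha> a b q M j =
      P * W * C * ((1 - \<alpha> * x\<^sup>2) * (x * (1 - q * Q) / (x - q * Q) -
      (1 - \<alpha> * a * b * Q / q) * (1 - \<alpha> * q * Q * x) / D))"
  proof -
    have "u * (X * W) * (C * P) - P * k / D * (u * W * (y * C)) = P * W * C * (u * (X - k * y / D))"
      for u X k y
      by (simp add: algebra_simps)
    then show ?thesis
      unfolding S S' R .
  qed
  also have "\<dots> = vwp_antidiff \<alpha> a b q M (Suc j) - vwp_antidiff \<alpha> a b q M j"
    unfolding G G'' D_def
    using nz xQ by (subst vwp_certificate[OF assms(1)]) (simp_all add: Q_def algebra_simps)
  finally show ?thesis .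
qed

text \<open>
  The top of the telescoping sum, where the common part of the previous proof would be
  \<open>1 / (1 - \<alpha> q\<^sup>2\<^sup>M\<^sup>+\<^sup>1)\<close>. The extra summand \<open>j = M + 1\<close> takes the place of minus the
  antidifference at \<open>M + 1\<close>, and the identity is again the certificate, at \<open>x = Q\<close>.
\<close>
lemma vwp_boundary:
  fixes q :: "'a::field"
  assumes "q \<noteq> 0" "a \<noteq> 0" "b \<noteq> 0"
    and root: "\<And>k. 0 < k \<Longrightarrow> q ^ k \<noteq> 1"
    and nz: "1 - \<alpha> * a * q ^ M \<noteq> 0" "1 - \<alpha> * b * q ^ M \<noteq> 0"
  shows "vwp_summand \<alpha> a b q (Suc M) M - vwp_step \<alpha> a b q M * vwp_summand \<alpha> a b q M M
     + vwp_summand \<alpha> a b q (Suc M) (Suc M) = - vwp_antidiff \<alpha> a b q M M"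
proof -
  define Q D W P1 P2 where "Q = q ^ M"
    and "D = (1 - \<alpha> * a * Q) * (1 - \<alpha> * b * Q)"
    and "W = wp_term \<alpha> a b q M M"
    and "P1 = 1 - \<alpha> * q * Q * Q" and "P2 = 1 - \<alpha> * q ^ (2 * M + 2)"
  have Q: "Q \<noteq> 0" "1 - q * Q \<noteq> 0" "Q - q * Q \<noteq> 0" "D \<noteq> 0"
    using assms(1) nz root[of "Suc M"] root[of 1] by (auto simp: Q_def D_def)
  have P1: "1 - \<alpha> * q ^ (2 * M + 1) = P1"
    by (simp add: P1_def Q_def mult.assoc mult_2 power_add)
  have x2: "q ^ (2 * M) = Q\<^sup>2"
    by (simp add: Q_def power2_eq_square mult_2 power_add)
  have P2: "1 - \<alpha> * q ^ (2 * Suc M) = P2" by (simp add: P2_def)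
  have W': "wp_term \<alpha> a b q (Suc M) M = Q * (1 - q * Q) / (Q - q * Q) * W"
    using wp_term_raise_M_divide[OF assms(1-3), of M M \<alpha>] Q(3) by (simp add: Q_def W_def)
  have S: "vwp_summand \<alpha> a b q M M = (1 - \<alpha> * Q\<^sup>2) * W"
    by (simp add: vwp_summand_def x2 W_def)
  have S': "vwp_summand \<alpha> a b q (Suc M) M =
      (1 - \<alpha> * Q\<^sup>2) * (Q * (1 - q * Q) / (Q - q * Q) * W) * P2"
    by (simp add: vwp_summand_def x2 W' P2_def qpoch_Suc mult_2[symmetric])
  have "vwp_summand \<alpha> a b q (Suc M) (Suc M) = P2 * (Q * (1 - q * Q) / (Q - q * Q) * W *
      ((1 - \<alpha> * Q) * (q * Q - Q) * (a - q * Q) * (b - q * Q) * \<alpha> /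
      (q * (1 - q * Q) * (1 - \<alpha> * a * Q) * (1 - \<alpha> * b * Q))))"
    unfolding vwp_summand_def P2 wp_term_Suc[OF assms(1-3)] W' by (simp add: Q_def)
  also have "\<dots> = - (P2 * W * (\<alpha> * Q * (1 - \<alpha> * Q) * (a - q * Q) * (b - q * Q) / (q * D)))"
  proof -
    have "P2 * (Q * u / y * W * (r * - y * s * t * \<alpha> / (q * u * A * B))) =
      - (P2 * W * (\<alpha> * Q * r * s * t / (q * (A * B))))"
      if "u \<noteq> 0" "y \<noteq> 0" "A * B \<noteq> 0" for r s t u y A B
      using that assms(1) by (simp add: field_simps)
    from this[OF Q(2,3)] Q(4) show ?thesis by (simp add: D_def)
  qed
  finally have S'': "vwp_summand \<alpha> a b q (Suc M) (Suc M) =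
      - (P2 * W * (\<alpha> * Q * (1 - \<alpha> * Q) * (a - q * Q) * (b - q * Q) / (q * D)))" .
  have R: "vwp_step \<alpha> a b q M = P1 * P2 * (1 - \<alpha> * a * b * Q / q) / D"
    unfolding vwp_step_def P1 P2_def[symmetric] Q_def[symmetric] D_def ..
  have G: "vwp_antidiff \<alpha> a b q M M = - (P2 * W * (q * Q * (1 - Q) * (1 - \<alpha> * a * Q / q) *
      (1 - \<alpha> * b * Q / q) * (1 - \<alpha> * q * Q * Q) / (D * (Q - q * Q))))"
    unfolding vwp_antidiff_def P1 P2_def[symmetric] Q_def[symmetric] W_def[symmetric] D_def[symmetric]
    by (simp add: P1_def)
  have "vwp_summand \<alpha> a b q (Suc M) M - vwp_step \<alpha> a b q M * vwp_summand \<alpha> a b q M M =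
      P2 * W * ((1 - \<alpha> * Q\<^sup>2) * (Q * (1 - q * Q) / (Q - q * Q) -
      (1 - \<alpha> * a * b * Q / q) * (1 - \<alpha> * q * Q * Q) / D))"
    unfolding S S' R P1_def[symmetric] by (simp add: algebra_simps)
  also have "\<dots> = - vwp_summand \<alpha> a b q (Suc M) (Suc M) - vwp_antidiff \<alpha> a b q M M"
    unfolding S'' G D_def
    using nz Q by (subst vwp_certificate[OF assms(1)]) (simp_all add: Q_def algebra_simps)
  finally show ?thesis by (simp add: algebra_simps)
qed

text \<open>
  Rogers' terminating \<open>\<^sub>6\<phi>\<^sub>5\<close> sum. Since \<open>(\<alpha>; q)\<^sub>2\<^sub>M\<^sub>+\<^sub>1 = (1 - \<alpha>) (\<alpha> q; q)\<^sub>M (\<alpha> q\<^sup>M\<^sup>+\<^sup>1; q)\<^sub>M\<close>, division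
  by the normalising factor gives the usual form whenever that factor is nonzero; here \<open>\<alpha>\<close> may
  also be an exceptional value.
\<close>
lemma vwp_sum:
  fixes q :: "'a::field"
  assumes "q \<noteq> 0" "a \<noteq> 0" "b \<noteq> 0"
    and root: "\<And>k. 0 < k \<Longrightarrow> q ^ k \<noteq> 1"
    and "qpoch (\<alpha> * a) q M \<noteq> 0" "qpoch (\<alpha> * b) q M \<noteq> 0"
  shows "(\<Sum>j\<le>M. vwp_summand \<alpha> a b q M j) =
     qpoch \<alpha> q (2 * M + 1) * qpoch (\<alpha> * a * b / q) q M /
     (qpoch (\<alpha> * a) q M * qpoch (\<alpha> * b) q M)"
  using assms(5,6)
proof (induction M)
  case 0
  then show ?case by (simp add: vwp_summand_def qpoch_Suc)
next
  case (Suc M)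
  let ?S = "vwp_summand \<alpha> a b q" and ?R = "vwp_step \<alpha> a b q M" and ?G = "vwp_antidiff \<alpha> a b q M"
  have nz: "1 - \<alpha> * a * q ^ j \<noteq> 0" "1 - \<alpha> * b * q ^ j \<noteq> 0" if "j \<le> M" for j
    using Suc.prems that qpoch_nonzero_mono[of _ q "Suc M" "Suc j"] by (auto simp: qpoch_Suc)
  have "(\<Sum>j<M. ?S (Suc M) j - ?R * ?S M j) = (\<Sum>j<M. ?G (Suc j) - ?G j)"
    by (rule sum.cong[OF refl], rule vwp_antidiff_Suc[OF assms(1-3) _ root]) (use nz in auto)
  also have "\<dots> = ?G M"
    by (subst sum_lessThan_telescope) (simp add: vwp_antidiff_def)
  finally have "(\<Sum>j\<le>Suc M. ?S (Suc M) j) = ?R * (\<Sum>j\<le>M. ?S M j)"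
    using vwp_boundary[OF assms(1-3) root nz[OF order_refl]]
    by (simp add: sum_subtractf sum_distrib_left distrib_left lessThan_Suc_atMost[symmetric] algebra_simps)
  also have "\<dots> = ?R * (qpoch \<alpha> q (2 * M + 1) * qpoch (\<alpha> * a * b / q) q M /
     (qpoch (\<alpha> * a) q M * qpoch (\<alpha> * b) q M))"
    using Suc.prems by (subst Suc.IH) (auto simp: qpoch_Suc)
  also have "\<dots> = qpoch \<alpha> q (2 * Suc M + 1) * qpoch (\<alpha> * a * b / q) q (Suc M) /
     (qpoch (\<alpha> * a) q (Suc M) * qpoch (\<alpha> * b) q (Suc M))"
    by (simp add: vwp_step_def qpoch_Suc ac_simps)
  finally show ?case .
qed

section \<open>Coefficients of the expansion\<close>

definition expansion_coeff :: "'a::field \<Rightarrow> 'a \<Rightarrow> 'a \<Rightarrow> 'a \<Rightarrow> nat \<Rightarrow> nat \<Rightarrow> 'a" where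
  "expansion_coeff \<alpha> a b q m n = (1 - \<alpha> * q ^ (2 * n)) *
     (qpoch (1 / q ^ m) q n * qpoch \<alpha> q n * qpoch (q / a) q n * qpoch (q / b) q n) *
     (\<alpha> * a * b * q ^ m / q) ^ n /
     ((1 - \<alpha>) * (qpoch q q n * qpoch (\<alpha> * q ^ (m + 1)) q n * qpoch (\<alpha> * a) q n * qpoch (\<alpha> * b) q n))"

text \<open>
  The part of the coefficient of \<open>A k\<close> that does not depend on \<open>j = n - k\<close>. The product over \<open>i\<close>
  is \<open>(q; q)\<^sub>k / (q\<^sup>-\<^sup>k; q)\<^sub>k\<close>.
\<close>
definition shift_factor :: "'a::field \<Rightarrow> 'a \<Rightarrow> 'a \<Rightarrow> 'a \<Rightarrow> nat \<Rightarrow> nat \<Rightarrow> 'a" where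
  "shift_factor \<alpha> a b q m k =
     qpoch (1 / q ^ m) q k * qpoch \<alpha> q (2 * k) * qpoch (q / a) q k * qpoch (q / b) q k *
     (\<alpha> * a * b * q ^ m / q) ^ k /
     ((1 - \<alpha>) * (\<Prod>i<k. - (q * q ^ (k - Suc i))) * qpoch (\<alpha> * a) q k * qpoch (\<alpha> * b) q k *
      qpoch (\<alpha> * q ^ (m + 1)) q m)"

text \<open>
  Each shifted factorial of length \<open>k + j\<close> splits into one of length \<open>k\<close> and one of length \<open>j\<close>, the
  latter with the shifted parameter. The factors \<open>(\<alpha>; q)\<^sub>n (\<alpha> q\<^sup>n; q)\<^sub>k = (\<alpha>; q)\<^sub>n\<^sub>+\<^sub>k\<close>
  combine first, so that they split as \<open>(\<alpha>; q)\<^sub>2\<^sub>k (\<alpha> q\<^sup>2\<^sup>k; q)\<^sub>j\<close>.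
\<close>
lemma expansion_coeff_shift:
  fixes q :: "'a::field"
  assumes "q \<noteq> 0" "a \<noteq> 0" "b \<noteq> 0"
    and root: "\<And>k. 0 < k \<Longrightarrow> q ^ k \<noteq> 1"
    and nz: "qpoch (\<alpha> * q ^ (m + 1)) q m \<noteq> 0"
    and "k + j \<le> m"
  shows "expansion_coeff \<alpha> a b q m (k + j) *
      (qpoch (1 / q ^ (k + j)) q k * qpoch (\<alpha> * q ^ (k + j)) q k) =
    shift_factor \<alpha> a b q m k * vwp_summand (\<alpha> * q ^ (2 * k)) (a / q ^ k) (b / q ^ k) q (m - k) j"
proof -
  have k2: "q ^ (2 * k) = q ^ k * q ^ k"
    by (simp add: mult_2 power_add)
  have m: "q ^ m = q ^ (m - k) * q ^ k"
    using assms(6) by (simp flip: power_add)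
  have e1: "qpoch (1 / q ^ m) q (k + j) = qpoch (1 / q ^ m) q k * qpoch (1 / q ^ (m - k)) q j"
    unfolding qpoch_add using assms(1) by (simp add: m)
  have e2: "qpoch (q / a) q (k + j) = qpoch (q / a) q k * qpoch (q / (a / q ^ k)) q j"
    "qpoch (q / b) q (k + j) = qpoch (q / b) q k * qpoch (q / (b / q ^ k)) q j"
    unfolding qpoch_add by simp_all
  have e3: "qpoch (\<alpha> * a) q (k + j) = qpoch (\<alpha> * a) q k * qpoch (\<alpha> * q ^ (2 * k) * (a / q ^ k)) q j"
    "qpoch (\<alpha> * b) q (k + j) = qpoch (\<alpha> * b) q k * qpoch (\<alpha> * q ^ (2 * k) * (b / q ^ k)) q j"
    unfolding qpoch_add k2 using assms(1) by (simp_all add: ac_simps)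
  have "k + j + k = 2 * k + j" by simp
  then have e4: "qpoch \<alpha> q (k + j) * qpoch (\<alpha> * q ^ (k + j)) q k =
      qpoch \<alpha> q (2 * k) * qpoch (\<alpha> * q ^ (2 * k)) q j"
    by (metis qpoch_add)
  have e5: "(\<alpha> * a * b * q ^ m / q) ^ (k + j) =
      (\<alpha> * a * b * q ^ m / q) ^ k *
      (q ^ (j * k) * (\<alpha> * q ^ (2 * k) * (a / q ^ k) * (b / q ^ k) * q ^ (m - k) / q) ^ j)"
  proof -
    have "\<alpha> * a * b * q ^ m / q =
        q ^ k * (\<alpha> * q ^ (2 * k) * (a / q ^ k) * (b / q ^ k) * q ^ (m - k) / q)"
      unfolding k2 m using assms(1) by simp
    then have "(\<alpha> * a * b * q ^ m / q) ^ j =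
        q ^ (j * k) * (\<alpha> * q ^ (2 * k) * (a / q ^ k) * (b / q ^ k) * q ^ (m - k) / q) ^ j"
      by (metis power_mult_distrib power_mult mult.commute)
    then show ?thesis unfolding power_add by simp
  qed
  note e6 = qpoch_inverse_power[OF assms(1), of k j]
  have "2 * k + (m - k + 1 + j) = m + 1 + (k + j)" using assms(6) by simp
  then have shift: "\<alpha> * q ^ (2 * k) * q ^ (m - k + 1 + j) = \<alpha> * q ^ (m + 1) * q ^ (k + j)"
    by (simp only: mult.assoc power_add[symmetric])
  have e7: "qpoch (\<alpha> * q ^ (m + 1)) q m = qpoch (\<alpha> * q ^ (m + 1)) q (k + j) *
      qpoch (\<alpha> * q ^ (2 * k) * q ^ (m - k + 1 + j)) q (m - k - j)"
    unfolding shift using assms(6) qpoch_add[of "\<alpha> * q ^ (m + 1)" q "k + j" "m - k - j"] by simp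
  have e8: "\<alpha> * q ^ (2 * (k + j)) = \<alpha> * q ^ (2 * k) * q ^ (2 * j)"
    by (simp add: distrib_left power_add)
  have nz': "qpoch q q (k + j) \<noteq> 0"
    using qpoch_self_nonzero[OF root] .
  \<comment> \<open>The rearrangement of factors is stated with variables so that no factorial is expanded.
     Only \<open>i\<close>, \<open>h\<close> and \<open>e\<close> are cancelled; they stand for \<open>(q\<^sup>-\<^sup>n; q)\<^sub>k\<close>, \<open>q\<^sup>j\<^sup>k\<close> and
     \<open>(\<alpha> q\<^sup>m\<^sup>+\<^sup>1\<^sup>+\<^sup>n; q)\<^sub>m\<^sub>-\<^sub>n\<close>.\<close>
  have regroup: "u * (x1 * x2 * al * (y1 * y2) * (z1 * z2)) * (p * (h * pj)) /
       (g * (s * i * (h * r) * t * (v1 * v2) * (w1 * w2))) * (i * al') =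
     x1 * al1 * y1 * z1 * p / (g * r * v1 * w1 * (t * e)) *
       (u * (x2 * al2 * y2 * z2 * pj / (s * v2 * w2)) * e)"
    if "al * al' = al1 * al2" "s * i * (h * r) \<noteq> 0" "t * e \<noteq> 0"
    for u x1 x2 al al' al1 al2 y1 y2 z1 z2 p h pj g s i r t v1 v2 w1 w2 e :: 'a
  proof -
    have "u * (x1 * x2 * al * (y1 * y2) * (z1 * z2)) * (p * (h * pj)) /
       (g * (s * i * (h * r) * t * (v1 * v2) * (w1 * w2))) * (i * al') =
       (i * h * (u * x1 * x2 * (al * al') * y1 * y2 * z1 * z2 * p * pj)) /
       (i * h * (g * s * r * t * v1 * v2 * w1 * w2))"
      by (simp add: ac_simps)
    also have "\<dots> = (e * (u * x1 * x2 * (al1 * al2) * y1 * y2 * z1 * z2 * p * pj)) /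
       (e * (g * s * r * t * v1 * v2 * w1 * w2))"
      using that by (simp only: mult_divide_mult_cancel_left mult_eq_0_iff de_Morgan_disj) simp
    finally show ?thesis
      by (simp add: ac_simps)
  qed
  show ?thesis
    unfolding expansion_coeff_def shift_factor_def vwp_summand_def wp_term_def e8
    unfolding e1 e2 e3 e5 e6 e7
    by (rule regroup[OF e4 nz'[unfolded e6] nz[unfolded e7]])
qed

text \<open>
  The factors combine pairwise: those in \<open>\<alpha>\<close> to \<open>(\<alpha>; q)\<^sub>2\<^sub>m\<^sub>+\<^sub>1\<close>, which supplies the factor \<open>1 - \<alpha>\<close>
  to be cancelled, and those in \<open>\<alpha> a\<close> and \<open>\<alpha> b\<close> to length \<open>m\<close>. The factorial \<open>(\<alpha> a b / q; q)\<^sub>m\<^sub>-\<^sub>k\<close>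
  is completed to length \<open>m\<close> by its last \<open>k\<close> factors, whose reversal is the denominator
  \<open>(q\<^sup>2 / (\<alpha> a b q\<^sup>m); q)\<^sub>k\<close>.
\<close>
lemma shift_factor_vwp_sum:
  fixes q :: "'a::field"
  assumes "q \<noteq> 0" "a \<noteq> 0" "b \<noteq> 0" "\<alpha> \<noteq> 0" "1 - \<alpha> \<noteq> 0"
    and "qpoch (\<alpha> * q ^ (m + 1)) q m \<noteq> 0" "qpoch (q\<^sup>2 / (\<alpha> * a * b * q ^ m)) q m \<noteq> 0"
    and "qpoch (\<alpha> * a) q m \<noteq> 0" "qpoch (\<alpha> * b) q m \<noteq> 0"
    and root: "\<And>k. 0 < k \<Longrightarrow> q ^ k \<noteq> 1"
    and "k \<le> m"
  shows "shift_factor \<alpha> a b q m k *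
      (\<Sum>j\<le>m - k. vwp_summand (\<alpha> * q ^ (2 * k)) (a / q ^ k) (b / q ^ k) q (m - k) j) =
    qpoch (\<alpha> * q) q m * qpoch (\<alpha> * a * b / q) q m / (qpoch (\<alpha> * a) q m * qpoch (\<alpha> * b) q m) *
    (qpoch (1 / q ^ m) q k * qpoch (q / a) q k * qpoch (q / b) q k /
      qpoch (q\<^sup>2 / (\<alpha> * a * b * q ^ m)) q k)"
proof -
  define M where "M = m - k"
  have m: "m = k + M" using assms(11) by (simp add: M_def)
  have k2: "q ^ (2 * k) = q ^ k * q ^ k"
    by (simp add: mult_2 power_add)
  define c where "c = \<alpha> * a * b / q * q ^ M"
  define r where "r = (\<Prod>i<k. - (q * q ^ (k - Suc i)))"
  define s where "s = (\<Prod>i<k. - (c * q ^ (k - Suc i)))"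
  have r: "r \<noteq> 0" using assms(1) by (simp add: r_def)
  have e1: "qpoch (\<alpha> * a) q m = qpoch (\<alpha> * a) q k * qpoch (\<alpha> * q ^ (2 * k) * (a / q ^ k)) q M"
    "qpoch (\<alpha> * b) q m = qpoch (\<alpha> * b) q k * qpoch (\<alpha> * q ^ (2 * k) * (b / q ^ k)) q M"
    unfolding m qpoch_add k2 using assms(1) by (simp_all add: ac_simps)
  \<comment> \<open>Both sides equal \<open>(\<alpha>; q)\<^sub>2\<^sub>m\<^sub>+\<^sub>1\<close>; nothing is divided by \<open>1 - \<alpha> q\<^sup>2\<^sup>k\<close>, which may be \<open>0\<close>.\<close>
  have "2 * k + (2 * M + 1) = Suc (m + m)" by (simp add: m)
  then have e2: "qpoch \<alpha> q (2 * k) * qpoch (\<alpha> * q ^ (2 * k)) q (2 * M + 1) =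
      (1 - \<alpha>) * (qpoch (\<alpha> * q) q m * qpoch (\<alpha> * q ^ (m + 1)) q m)"
    unfolding qpoch_add[symmetric] by (simp add: qpoch_Suc_left qpoch_add ac_simps)
  have e3: "qpoch (\<alpha> * a * b / q) q m =
      qpoch (\<alpha> * a * b / q) q M * (qpoch (q\<^sup>2 / (\<alpha> * a * b * q ^ m)) q k * s)"
  proof -
    have "c \<noteq> 0" using assms by (simp add: c_def)
    have "q / (c * q ^ k) = q\<^sup>2 / (\<alpha> * a * b * q ^ m)"
      using assms(1) by (simp add: c_def m power_add power2_eq_square ac_simps)
    with qpoch_reverse[OF \<open>c \<noteq> 0\<close> assms(1), of k] show ?thesis
      using qpoch_add[of "\<alpha> * a * b / q" q M k] by (simp add: m add.commute c_def s_def)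
  qed
  have e4: "(\<alpha> * a * b * q ^ m / q) ^ k = r * s"
    unfolding r_def s_def prod_power_pair by (simp add: c_def m power_add ac_simps)
  have e5: "\<alpha> * q ^ (2 * k) * (a / q ^ k) * (b / q ^ k) / q = \<alpha> * a * b / q"
    unfolding k2 using assms(1) by simp
  have d: "qpoch (q\<^sup>2 / (\<alpha> * a * b * q ^ m)) q k \<noteq> 0"
    using qpoch_nonzero_mono assms(7,11) by blast
  have sum: "(\<Sum>j\<le>M. vwp_summand (\<alpha> * q ^ (2 * k)) (a / q ^ k) (b / q ^ k) q M j) =
     qpoch (\<alpha> * q ^ (2 * k)) q (2 * M + 1) * qpoch (\<alpha> * a * b / q) q M /
     (qpoch (\<alpha> * q ^ (2 * k) * (a / q ^ k)) q M * qpoch (\<alpha> * q ^ (2 * k) * (b / q ^ k)) q M)"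
    unfolding e5[symmetric]
    by (rule vwp_sum) (use assms(1-3) assms(8,9)[unfolded e1] root in auto)
  have regroup: "x * al * y * z * (r * s) / (g * r * v1 * w1 * t) * (al' * p / (v2 * w2)) =
      l * (p * (d * s)) / (v1 * v2 * (w1 * w2)) * (x * y * z / d)"
    if "al * al' = g * (l * t)" "d \<noteq> 0" "g \<noteq> 0" "t \<noteq> 0" "v1 * v2 \<noteq> 0" "w1 * w2 \<noteq> 0"
    for x al y z g v1 v2 w1 w2 t al' p l d
  proof -
    have "x * al * y * z * (r * s) / (g * r * v1 * w1 * t) * (al' * p / (v2 * w2)) =
      (al * al') * (x * y * z * (r * s) * p) / (g * r * v1 * w1 * t * (v2 * w2))"
      by (simp add: ac_simps)
    then show ?thesis unfolding that(1) using that(2-) r by (simp add: field_simps)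
  qed
  show ?thesis
    unfolding M_def[symmetric] sum shift_factor_def e4 r_def[symmetric]
    using regroup[OF e2 d assms(5,6) assms(8)[unfolded e1] assms(9)[unfolded e1]] unfolding e1 e3 .
qed

section \<open>The expansion formula\<close>

theorem q_expansion:
  fixes q :: "'a::field"
  assumes "q \<noteq> 0" "a \<noteq> 0" "b \<noteq> 0" "\<alpha> \<noteq> 0" "1 - \<alpha> \<noteq> 0"
    and "qpoch (\<alpha> * q ^ (m + 1)) q m \<noteq> 0" "qpoch (q\<^sup>2 / (\<alpha> * a * b * q ^ m)) q m \<noteq> 0"
    and "qpoch (\<alpha> * a) q m \<noteq> 0" "qpoch (\<alpha> * b) q m \<noteq> 0"
    and root: "\<And>k. 0 < k \<Longrightarrow> q ^ k \<noteq> 1"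
  shows "qpoch (\<alpha> * q) q m * qpoch (\<alpha> * a * b / q) q m / (qpoch (\<alpha> * a) q m * qpoch (\<alpha> * b) q m) *
      (\<Sum>k\<le>m. qpoch (1 / q ^ m) q k * qpoch (q / a) q k * qpoch (q / b) q k * q ^ k /
        qpoch (q\<^sup>2 / (\<alpha> * a * b * q ^ m)) q k * A k) =
    (\<Sum>n\<le>m. expansion_coeff \<alpha> a b q m n *
      (\<Sum>k\<le>n. qpoch (1 / q ^ n) q k * qpoch (\<alpha> * q ^ n) q k * q ^ k * A k))"
proof -
  define T where "T n k = expansion_coeff \<alpha> a b q m n *
      (qpoch (1 / q ^ n) q k * qpoch (\<alpha> * q ^ n) q k)" for n k
  define L where "L = qpoch (\<alpha> * q) q m * qpoch (\<alpha> * a * b / q) q m /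
      (qpoch (\<alpha> * a) q m * qpoch (\<alpha> * b) q m)"
  have coeff: "(\<Sum>n=k..m. T n k) = L * (qpoch (1 / q ^ m) q k * qpoch (q / a) q k * qpoch (q / b) q k /
      qpoch (q\<^sup>2 / (\<alpha> * a * b * q ^ m)) q k)" if "k \<le> m" for k
  proof -
    have "(\<Sum>n=k..m. T n k) = (\<Sum>j\<le>m - k. T (k + j) k)"
      using that by (subst sum.atLeastAtMost_shift_0) (simp_all add: atMost_atLeast0)
    also have "\<dots> = shift_factor \<alpha> a b q m k *
        (\<Sum>j\<le>m - k. vwp_summand (\<alpha> * q ^ (2 * k)) (a / q ^ k) (b / q ^ k) q (m - k) j)"
      unfolding sum_distrib_left T_def
      by (rule sum.cong[OF refl], rule expansion_coeff_shift[OF assms(1-3) root assms(6)])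
         (use that in auto)
    also note shift_factor_vwp_sum[OF assms that]
    finally show ?thesis unfolding L_def .
  qed
  have "(\<Sum>n\<le>m. expansion_coeff \<alpha> a b q m n *
      (\<Sum>k\<le>n. qpoch (1 / q ^ n) q k * qpoch (\<alpha> * q ^ n) q k * q ^ k * A k)) =
      (\<Sum>n\<le>m. \<Sum>k\<in>{k\<in>{..m}. k \<le> n}. T n k * (q ^ k * A k))"
    unfolding sum_distrib_left T_def
    by (intro sum.cong) (auto simp: ac_simps)
  also have "\<dots> = (\<Sum>k\<le>m. \<Sum>n\<in>{n\<in>{..m}. k \<le> n}. T n k * (q ^ k * A k))"
    by (rule sum.swap_restrict) auto
  also have "\<dots> = (\<Sum>k\<le>m. (\<Sum>n=k..m. T n k) * (q ^ k * A k))"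
    unfolding sum_distrib_right by (intro sum.cong) auto
  also have "\<dots> = (\<Sum>k\<le>m. L * (qpoch (1 / q ^ m) q k * qpoch (q / a) q k * qpoch (q / b) q k * q ^ k /
      qpoch (q\<^sup>2 / (\<alpha> * a * b * q ^ m)) q k * A k))"
    by (rule sum.cong[OF refl]) (simp add: coeff)
  finally show ?thesis
    unfolding L_def[symmetric] by (simp only: sum_distrib_left)
qed

theorem theorem9p2:
  fixes q :: real and m :: nat and A :: "nat \<Rightarrow> complex" and \<alpha> a b :: complex
  assumes "0 < q" and "q < 1"
    and "\<alpha> \<noteq> 0" and "a \<noteq> 0" and "b \<noteq> 0" and "1 - \<alpha> \<noteq> 0"
    and "qpochs [\<alpha> * a, \<alpha> * b] q m \<noteq> 0"
    and "qpoch (q ^ 2 / (\<alpha> * a * b * q ^ m)) q m \<noteq> 0"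
    and "qpoch (\<alpha> * q ^ (m + 1)) q m \<noteq> 0"
  shows "qpochs [\<alpha> * q, \<alpha> * a * b / q] q m / qpochs [\<alpha> * a, \<alpha> * b] q m *
      (\<Sum>n=0..m. qpochs [complex_of_real q powi (- int m), q / a, q / b] q n * q ^ n /
         qpoch (q ^ 2 / (\<alpha> * a * b * q ^ m)) q n * A n) =
    (\<Sum>n=0..m. (1 - \<alpha> * q ^ (2 * n)) *
         qpochs [complex_of_real q powi (- int m), \<alpha>, q / a, q / b] q n *
         (\<alpha> * a * b * complex_of_real q powi (int m - 1)) ^ n /
         ((1 - \<alpha>) * qpochs [complex_of_real q, \<alpha> * q ^ (m + 1), \<alpha> * a, \<alpha> * b] q n) *
         (\<Sum>k=0..n. qpochs [complex_of_real q powi (- int n), \<alpha> * q ^ n] q k * q ^ k * A k))"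
proof -
  define p where "p = complex_of_real q"
  have p: "p \<noteq> 0" using assms(1) by (simp add: p_def)
  have root: "p ^ k \<noteq> 1" if "0 < k" for k
  proof -
    have "q ^ k < 1" using assms(1,2) that by (simp add: power_less_one_iff)
    then show ?thesis unfolding p_def by (simp flip: of_real_power)
  qed
  have powi: "p powi (- int n) = 1 / p ^ n" "p powi (int n - 1) = p ^ n / p" for n
    using p by (simp_all add: power_int_minus power_int_diff field_simps)
  show ?thesis
    using q_expansion[of p a b \<alpha> m A, OF p assms(4,5,3,6) _ _ _ _ root] assms(7-9)
    unfolding of_real_power p_def[symmetric] powi
    by (simp add: qpochs_def expansion_coeff_def atMost_atLeast0 mult.assoc)
qed

end
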